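(* There do not exist a quantum computer (QC) with oracle and functions $t(n), T(n)$ of the input length $n$ with $t(n)/T(n)\to 0$ as $n\to\infty$ and $T(n)=O(2^{n/7})$ such that, for every length preserving function $f:\{0,1\}^*\to\{0,1\}^*$, this QC supplied with the oracle for $f$ computes $f^{\{T(n)\}}(\bar 0)$, where $\bar 0=0^n$, applying only $t(n)$ evaluations of $f$ (i.e. only $t(n)$ query transforms) on inputs of length $n$.
   Context: **Iteration.** A function $f:\{0,1\}^*\to\{0,1\}^*$ is length preserving if $|f(x)|=|x|$ for all $x$. Its iterates are $f^{\{0\}}=$ identity, $f^{\{k+1\}}(x)=f(f^{\{k\}}(x))$. $\bar 0=0^n$ is the all-zero word of length $n$. **Quantum computer (QC) with oracle.** It has a quantum and a classical part; the machine is fixed independently of $f$, and $f$ enters only through the oracle. Let $L=L(n)$ denote the time complexity (number of steps) of the QC on inputs of length $n$. *Quantum part.* It has a working tape with qubits $v_1,\dots,v_L$ and a query tape with qubits $v_{L+1},\dots,v_{L+2n}$. Basic states are the words of $\{0,1\}^{L+2n}$; with $K=2^{L+2n}$ they are listed as $e_0,\dots,e_{K-1}$ and form an orthonormal basis of the Hilbert space $\mathcal H=\mathcal H_1\otimes\cdots\otimes\mathcal H_{L+2n}$, each factor $\mathcal H_i\cong\mathbb C^2$ belonging to $v_i$. A state of the quantum part is a unit vector in $\mathcal H$. There is a finite set $\mathcal U$ of available unitary transformations (each on some $2^k$-dimensional space). For $G\subset\{1,\dots,L+2n\}$ and $U\in\mathcal U$ acting on a $2^{|G|}$-dimensional space,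 the working transform $W_{G,U}$ acts as $U$ on $\bigotimes_{i\in G}\mathcal H_i$ and as the identity on $\bigotimes_{i\notin G}\mathcal H_i$. The query transform $\mathrm{Qu}_f$ acts as the identity on the working qubits and on the query qubits by $|\bar a,\bar b\rangle\mapsto|\bar a,f(\bar a)\oplus\bar b\rangle$, $\bar a,\bar b\in\{0,1\}^n$, where $\oplus$ is bitwise addition modulo 2. Observation of the state $\sum_i\lambda_ie_i$ gives $e_i$ with probability $|\lambda_i|^2$. *Classical part.* It has two classical tapes whose cells correspond one-to-one to the qubits, with letters from a finite alphabet $\omega$, evolving by a classical Turing machine $M$ with several heads and a finite set of integrated head states including $q_b,q_w,q_q,q_o$; $h(C)$ denotes the head state of a classical state $C$. A rule of correspondence assigns to each classical state $C$ a pair $R(C)=\langle G,U\rangle$, where $U\in\mathcal U$ depends only on $h(C)$ and acts on a $2^{|G|}$-dimensional space, and $G$ is the set of numbers of those cells containing a special letter $a_0\in\omega$. *Computation.* A state is a pair $S=\langle Q(S),C(S)\rangle$ of quantum and classical states. A computation is a chain $S_0\to S_1\to\cdots\to S_L$ in which each $C(S_i)\to C(S_{i+1})$ is a step of $M$ and: if $h(C(S_i))=q_w$ then $Q(S_{i+1})=W_{R(C(S_i))}(Q(S_i))$; if $h(C(S_i))=q_q$ then $Q(S_{i+1})=\mathrm{Qu}_f(Q(S_i))$; if $h(C(S_i))=q_b$ then $i=0$, $Q(S_0)=e_0$, and $C(S_0)$ is the fixed initial state corresponding to the input word $a\in\{0,1\}^n$; if $h(C(S_i))=q_o$ then $i=L$;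 in other cases $Q(S_{i+1})=Q(S_i)$. The number of evaluations of $f$ is the number of query transforms $\mathrm{Qu}_f$ in the chain. *Computing a function.* The QC computes a function $F(a)$ if, for some probability $p\ge 2/3$, on every input $a$ the observation of the final state $S_L$ followed by a routine classical procedure fixed beforehand gives $F(a)$ with probability $p$. Here the value to be computed on inputs of length $n$ is $f^{\{T(n)\}}(0^n)$. *)

theory Defs
  imports "HOL-Analysis.Analysis" "HOL-Library.Landau_Symbols"
begin

text \<open>Words over \<open>{0,1}\<close> are boolean lists (\<open>False\<close> = 0, \<open>True\<close> = 1).\<close>

definition words :: "nat \<Rightarrow> bool list set" where
  "words n = {w. length w = n}"

definition zero_word :: "nat \<Rightarrow> bool list" where
  "zero_word n = replicate n False"

definition word_xor :: "bool list \<Rightarrow> bool list \<Rightarrow> bool list" where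
  "word_xor x y = map2 (\<noteq>) x y"

definition length_preserving :: "(bool list \<Rightarrow> bool list) \<Rightarrow> bool" where
  "length_preserving f \<longleftrightarrow> (\<forall>x. length (f x) = length x)"

text \<open>
  A vector of the \<open>N\<close>-qubit space is its coefficient function with respect to the basic states,
  i.e. the words of length \<open>N\<close>, and is \<open>0\<close> on all other words. A linear operator is given by
  its matrix, whose rows and columns are indexed by words.
\<close>

type_synonym qvec = "bool list \<Rightarrow> complex"
type_synonym qmat = "bool list \<Rightarrow> bool list \<Rightarrow> complex"

definition quantum_state :: "nat \<Rightarrow> qvec \<Rightarrow> bool" where
  "quantum_state N \<psi> \<longleftrightarrow>
     (\<forall>v. v \<notin> words N \<longrightarrow> \<psi> v = 0) \<and> (\<Sum>v\<in>words N. (cmod (\<psi> v))\<^sup>2) = 1"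

definition basic_state :: "bool list \<Rightarrow> qvec" where
  "basic_state w = (\<lambda>v. if v = w then 1 else 0)"

definition apply_mat :: "nat \<Rightarrow> qmat \<Rightarrow> qvec \<Rightarrow> qvec" where
  "apply_mat N A \<psi> = (\<lambda>v. if v \<in> words N then \<Sum>v'\<in>words N. A v v' * \<psi> v' else 0)"

text \<open>A gate \<open>(k, U)\<close> is a transformation \<open>U\<close> of the \<open>2 ^ k\<close>-dimensional space.\<close>

type_synonym gate = "nat \<times> qmat"

definition unitary_gate :: "gate \<Rightarrow> bool" where
  "unitary_gate g \<longleftrightarrow> (case g of (k, U) \<Rightarrow>
     \<forall>u\<in>words k. \<forall>v\<in>words k.
       (\<Sum>w\<in>words k. cnj (U w u) * U w v) = (if u = v then 1 else 0) \<and>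
       (\<Sum>w\<in>words k. U u w * cnj (U v w)) = (if u = v then 1 else 0))"

text \<open>
  \<open>nths v G\<close> is the subword of \<open>v\<close> at the positions in \<open>G\<close> (in increasing order), so this is the
  matrix of the tensor product of \<open>U\<close> on the qubits in \<open>G\<close> with the identity on the others.
  Qubits and cells are numbered from \<open>0\<close>.
\<close>

definition working_mat :: "nat set \<Rightarrow> qmat \<Rightarrow> qmat" where
  "working_mat G U = (\<lambda>v v'. if nths v (- G) = nths v' (- G) then U (nths v G) (nths v' G) else 0)"

definition query_map :: "nat \<Rightarrow> nat \<Rightarrow> (bool list \<Rightarrow> bool list) \<Rightarrow> bool list \<Rightarrow> bool list" where
  "query_map L n f v =
     (let a = take n (drop L v); b = drop (L + n) v
      in take L v @ a @ word_xor (f a) b)"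

definition query_mat :: "nat \<Rightarrow> nat \<Rightarrow> (bool list \<Rightarrow> bool list) \<Rightarrow> qmat" where
  "query_mat L n f = (\<lambda>v v'. if v = query_map L n f v' then 1 else 0)"

datatype tape = Working | Query

datatype move = MoveLeft | Stay | MoveRight

text \<open>
  Integrated head states \<open>'q\<close>, tape letters \<open>'s\<close>; \<open>head_pos\<close> lists the positions of the heads.
\<close>

record ('q, 's) cstate =
  head_state :: 'q
  cells :: "tape \<Rightarrow> 's list"
  head_pos :: "nat list"

text \<open>
  The list \<open>qc_heads\<close> says on which tape each head moves. The program maps the current head state
  and the letters seen by the heads to the new head state and, for each head, the letter written
  and the move. The tapes are finite; position \<open>length\<close>, just behind the last cell, is allowed for
  a head, which then sees \<open>None\<close> and writes nothing. \<open>qc_init\<close> gives the initial classical state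
  for each input word. \<open>qc_output\<close> is the classical procedure applied to the input word and the
  observed basic state.
\<close>

record ('q, 's) qc =
  qc_heads :: "tape list"
  qc_program :: "'q \<Rightarrow> 's option list \<Rightarrow> 'q \<times> ('s \<times> move) list"
  qc_qb :: 'q
  qc_qw :: 'q
  qc_qq :: 'q
  qc_qo :: 'q
  qc_a0 :: 's
  qc_gates :: "gate set"
  qc_gate_of :: "'q \<Rightarrow> gate"
  qc_time :: "nat \<Rightarrow> nat"
  qc_init :: "bool list \<Rightarrow> ('q, 's) cstate"
  qc_output :: "bool list \<Rightarrow> bool list \<Rightarrow> bool list"

definition wf_cstate :: "('q, 's) qc \<Rightarrow> nat \<Rightarrow> ('q, 's) cstate \<Rightarrow> bool" where
  "wf_cstate M n C \<longleftrightarrow>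
     length (cells C Working) = qc_time M n \<and>
     length (cells C Query) = 2 * n \<and>
     list_all2 (\<lambda>\<tau> p. p \<le> length (cells C \<tau>)) (qc_heads M) (head_pos C)"

definition quantum_computer :: "('q::finite, 's::finite) qc \<Rightarrow> bool" where
  "quantum_computer M \<longleftrightarrow>
     distinct [qc_qb M, qc_qw M, qc_qq M, qc_qo M] \<and>
     (\<forall>q xs. length xs = length (qc_heads M) \<longrightarrow>
        length (snd (qc_program M q xs)) = length (qc_heads M)) \<and>
     finite (qc_gates M) \<and> (\<forall>g\<in>qc_gates M. unitary_gate g) \<and>
     (\<forall>q. qc_gate_of M q \<in> qc_gates M) \<and>
     (\<forall>a. wf_cstate M (length a) (qc_init M a) \<and> head_state (qc_init M a) = qc_qb M)"

definition seen :: "('q, 's) qc \<Rightarrow> ('q, 's) cstate \<Rightarrow> 's option list" where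
  "seen M C = map2 (\<lambda>\<tau> p. if p < length (cells C \<tau>) then Some (cells C \<tau> ! p) else None)
     (qc_heads M) (head_pos C)"

text \<open>For a head at position \<open>p\<close> on a tape with \<open>l\<close> cells; heads cannot leave the tape.\<close>

fun move_head :: "nat \<Rightarrow> move \<Rightarrow> nat \<Rightarrow> nat" where
  "move_head l MoveLeft p = p - 1"
| "move_head l Stay p = p"
| "move_head l MoveRight p = min (Suc p) l"

text \<open>If several heads are on the same cell, the last one in \<open>qc_heads\<close> determines its letter.\<close>

definition classical_step :: "('q, 's) qc \<Rightarrow> ('q, 's) cstate \<Rightarrow> ('q, 's) cstate" where
  "classical_step M C =
     (let (q, acts) = qc_program M (head_state C) (seen M C);
          hs = zip (qc_heads M) (zip (head_pos C) acts)
      in \<lparr> head_state = q,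
           cells = fold (\<lambda>(\<tau>, p, x, m) c. c(\<tau> := (c \<tau>)[p := x])) hs (cells C),
           head_pos = map (\<lambda>(\<tau>, p, x, m). move_head (length (cells C \<tau>)) m p) hs \<rparr>)"

definition marked_cells :: "('q, 's) qc \<Rightarrow> ('q, 's) cstate \<Rightarrow> nat set" where
  "marked_cells M C =
     (let xs = cells C Working @ cells C Query in {i. i < length xs \<and> xs ! i = qc_a0 M})"

definition correspondence :: "('q, 's) qc \<Rightarrow> ('q, 's) cstate \<Rightarrow> nat set \<times> gate" where
  "correspondence M C = (marked_cells M C, qc_gate_of M (head_state C))"

definition qubits :: "('q, 's) qc \<Rightarrow> nat \<Rightarrow> nat" where
  "qubits M n = qc_time M n + 2 * n"

text \<open>
  One step of the quantum part. A working transform is only defined if the gate acts on as many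
  qubits as there are marked cells.
\<close>

definition quantum_step ::
    "('q, 's) qc \<Rightarrow> (bool list \<Rightarrow> bool list) \<Rightarrow> nat \<Rightarrow> ('q, 's) cstate \<Rightarrow> qvec \<Rightarrow> qvec \<Rightarrow> bool" where
  "quantum_step M f n C \<psi> \<psi>' \<longleftrightarrow>
     (if head_state C = qc_qw M then
        (case correspondence M C of (G, k, U) \<Rightarrow>
           card G = k \<and> \<psi>' = apply_mat (qubits M n) (working_mat G U) \<psi>)
      else if head_state C = qc_qq M then
        \<psi>' = apply_mat (qubits M n) (query_mat (qc_time M n) n f) \<psi>
      else \<psi>' = \<psi>)"

text \<open>The chain \<open>S 0, \<dots>, S L\<close> with \<open>L = qc_time M (length a)\<close>; later values of \<open>S\<close> are irrelevant.\<close>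

definition computation ::
    "('q, 's) qc \<Rightarrow> (bool list \<Rightarrow> bool list) \<Rightarrow> bool list \<Rightarrow> (nat \<Rightarrow> qvec \<times> ('q, 's) cstate) \<Rightarrow> bool" where
  "computation M f a S \<longleftrightarrow>
     (let n = length a; L = qc_time M n in
        S 0 = (basic_state (zero_word (qubits M n)), qc_init M a) \<and>
        (\<forall>i<L. snd (S (Suc i)) = classical_step M (snd (S i)) \<and>
               quantum_step M f n (snd (S i)) (fst (S i)) (fst (S (Suc i)))) \<and>
        (\<forall>i\<le>L. quantum_state (qubits M n) (fst (S i)) \<and>
               (head_state (snd (S i)) = qc_qb M \<longrightarrow> i = 0) \<and>
               (head_state (snd (S i)) = qc_qo M \<longrightarrow> i = L)))"

definition evaluations ::
    "('q, 's) qc \<Rightarrow> bool list \<Rightarrow> (nat \<Rightarrow> qvec \<times> ('q, 's) cstate) \<Rightarrow> nat" where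
  "evaluations M a S = card {i. i < qc_time M (length a) \<and> head_state (snd (S i)) = qc_qq M}"

definition result_prob :: "('q, 's) qc \<Rightarrow> bool list \<Rightarrow> qvec \<Rightarrow> bool list \<Rightarrow> real" where
  "result_prob M a \<psi> y =
     (\<Sum>w | w \<in> words (qubits M (length a)) \<and> qc_output M a w = y. (cmod (\<psi> w))\<^sup>2)"

definition computes ::
    "('q, 's) qc \<Rightarrow> (bool list \<Rightarrow> bool list) \<Rightarrow> (bool list \<Rightarrow> bool list) \<Rightarrow> bool" where
  "computes M f F \<longleftrightarrow>
     (\<exists>p::real. p \<ge> 2 / 3 \<and>
        (\<forall>a. \<exists>S. computation M f a S \<and>
           result_prob M a (fst (S (qc_time M (length a)))) (F a) \<ge> p))"

end

(* Let f act on words b # w, where w is read as the binary expansion of a number i, by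
   sending (b, i) to (b xor x_i, i + 1). Iterating f from the zero word T times then produces the
   parity of x_0, ..., x_(T-1). Every entry of a query matrix depends on a single bit x_i, so after
   t queries the amplitudes are polynomials of degree at most t in the bits of x, and the
   probabilities of the results have degree at most 2t (Beals, Buhrman, Cleve, Mosca, de Wolf).
   Polynomials of degree less than T are orthogonal to the parity of T bits, so 2t >= T. *)

theory Submission
  imports Defs "HOL-Real_Asymp.Real_Asymp"
begin

section \<open>Functions of bounded degree on sets\<close>

text \<open>The bits of \<open>x\<close> are the truth values \<open>i \<in> x\<close>; polynomials of degree at most \<open>d\<close> in
  these bits are the sums of functions that depend on at most \<open>d\<close> of them.\<close>

inductive degree_le :: "nat \<Rightarrow> ('a set \<Rightarrow> 'b::comm_ring_1) \<Rightarrow> bool" for d where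
  junta: "finite D \<Longrightarrow> card D \<le> d \<Longrightarrow> (\<And>x. F x = F (x \<inter> D)) \<Longrightarrow> degree_le d F"
| add: "degree_le d F \<Longrightarrow> degree_le d G \<Longrightarrow> degree_le d (\<lambda>x. F x + G x)"

lemma degree_le_const: "degree_le d (\<lambda>x. c)"
  by (rule junta[of "{}"]) auto

lemma degree_le_mono:
  assumes "degree_le d F" "d \<le> e"
  shows "degree_le e F"
  using assms(1)
proof induction
  case (junta D F)
  then show ?case
    using assms(2) by (intro degree_le.junta[of D]) auto
qed (rule degree_le.add)

text \<open>If one factor depends on the bits in \<open>D\<close> and the other on those in
  \<open>E\<close>, the product depends on those in \<open>D \<union> E\<close>, whose size is at
  most the sum. Sums are handled by distributivity, one induction for each factor.\<close>

lemma degree_le_mult: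
  assumes "degree_le d F" "degree_le e G"
  shows "degree_le (d + e) (\<lambda>x. F x * G x)"
  using assms(1)
proof induction
  case F: (junta D F)
  show ?case
    using assms(2)
  proof induction
    case G: (junta E G)
    show ?case
    proof (rule degree_le.junta)
      show "finite (D \<union> E)"
        using F G by simp
      show "card (D \<union> E) \<le> d + e"
        using card_Un_le[of D E] F(2) G(2) by linarith
      fix x
      have "F (x \<inter> (D \<union> E)) = F x"
        using F(3)[of x] F(3)[of "x \<inter> (D \<union> E)"] by (simp add: Int_assoc Int_absorb1)
      moreover have "G (x \<inter> (D \<union> E)) = G x"
        using G(3)[of x] G(3)[of "x \<inter> (D \<union> E)"] by (simp add: Int_assoc Int_absorb1)
      ultimately show "F x * G x = F (x \<inter> (D \<union> E)) * G (x \<inter> (D \<union> E))"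
        by simp
    qed
  next
    case (add G H)
    then show ?case
      using degree_le.add[OF add.IH] by (simp add: distrib_left)
  qed
next
  case (add F H)
  then show ?case
    using degree_le.add[OF add.IH] by (simp add: distrib_right)
qed

lemma degree_le_sum:
  assumes "\<And>v. v \<in> V \<Longrightarrow> degree_le d (F v)"
  shows "degree_le d (\<lambda>x. \<Sum>v\<in>V. F v x)"
  using assms by (induction V rule: infinite_finite_induct)
    (auto intro: degree_le_const degree_le.add)

lemma degree_le_cnj:
  assumes "degree_le d F"
  shows "degree_le d (\<lambda>x. cnj (F x))"
  using assms
proof induction
  case (junta D F)
  then show ?case
    by (intro degree_le.junta[of D]) auto
next
  case (add F G)
  then show ?case
    using degree_le.add[OF add.IH] by simp
qed

text \<open>A function of at most \<open>d\<close> bits ignores some bit \<open>i\<close> of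
  \<open>A\<close>. Toggling \<open>i\<close> flips the sign and keeps \<open>F\<close>, so the
  terms for \<open>x\<close> and \<open>insert i x\<close> cancel; linearity does the rest.\<close>

lemma sum_parity_degree_le:
  assumes "degree_le d F" "finite A" "d < card A"
  shows "(\<Sum>x\<in>Pow A. (- 1) ^ card x * F x) = 0"
  using assms(1)
proof induction
  case (junta D F)
  have "\<not> A \<subseteq> D"
    using junta assms card_mono[of D A] by auto
  then obtain i where i: "i \<in> A" "i \<notin> D"
    by auto
  define B where "B = A - {i}"
  have B: "A = insert i B" "i \<notin> B" "finite B"
    using i assms by (auto simp: B_def)
  have "(\<Sum>x\<in>insert i ` Pow B. (- 1) ^ card x * F x)
      = (\<Sum>x\<in>Pow B. (- 1) ^ card (insert i x) * F (insert i x))"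
    using B by (intro sum.reindex[unfolded comp_def]) (auto simp: inj_on_def)
  also have "\<dots> = (\<Sum>x\<in>Pow B. - ((- 1) ^ card x * F x))"
  proof (rule sum.cong[OF refl])
    fix x assume "x \<in> Pow B"
    then have "card (insert i x) = Suc (card x)"
      using B by (auto simp: finite_subset intro!: card_insert_disjoint)
    moreover have "F (insert i x) = F x"
      using junta(3)[of "insert i x"] junta(3)[of x] i by simp
    ultimately show "(- 1) ^ card (insert i x) * F (insert i x) = - ((- 1) ^ card x * F x)"
      by simp
  qed
  finally have "(\<Sum>x\<in>insert i ` Pow B. (- 1) ^ card x * F x)
      = - (\<Sum>x\<in>Pow B. (- 1) ^ card x * F x)"
    by (simp add: sum_negf)
  moreover have "Pow B \<inter> insert i ` Pow B = {}"
    using B by auto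
  ultimately show ?case
    using B by (simp add: Pow_insert sum.union_disjoint)
next
  case (add F G)
  then show ?case
    by (simp add: distrib_left sum.distrib)
qed

section \<open>Iterations that compute a parity\<close>

text \<open>The head of the word accumulates the parity; the tail is a counter with the least
  significant bit first, increased modulo \<open>2 ^ length w\<close>.\<close>

definition parity_step :: "nat set \<Rightarrow> bool list \<Rightarrow> bool list" where
  "parity_step x a = (case a of [] \<Rightarrow> [] | b # w \<Rightarrow>
     let i = horner_sum of_bool 2 w in (b \<noteq> (i \<in> x)) # map (bit (Suc i)) [0..<length w])"

lemma length_preserving_parity_step: "length_preserving (parity_step x)"
  by (auto simp: length_preserving_def parity_step_def Let_def split: list.split)

lemma parity_step_cong:
  "parity_step x a = parity_step (x \<inter> {horner_sum of_bool 2 (tl a)}) a"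
  by (auto simp: parity_step_def Let_def split: list.split)

text \<open>The bound on \<open>k\<close> keeps the counter from wrapping around before the last
  step, so each bit of \<open>x\<close> below \<open>k\<close> is added exactly once.\<close>

lemma parity_step_iterate:
  assumes "k \<le> 2 ^ m"
  shows "(parity_step x ^^ k) (zero_word (Suc m))
    = odd (card (x \<inter> {..<k})) # map (bit k) [0..<m]"
  using assms
proof (induction k)
  case 0
  then show ?case
    by (auto simp: zero_word_def map_replicate_const)
next
  case (Suc k)
  have "{..<Suc k} = insert k {..<k}"
    by auto
  then have "odd (card (x \<inter> {..<Suc k})) = (odd (card (x \<inter> {..<k})) \<noteq> (k \<in> x))"
    by (cases "k \<in> x") auto
  moreover have "horner_sum of_bool 2 (map (bit k) [0..<m]) = k"
    using Suc.prems by (simp add: horner_sum_bit_eq_take_bit take_bit_nat_eq_self)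
  ultimately show ?case
    using Suc by (simp add: parity_step_def Let_def)
qed

section \<open>Degrees of amplitudes and probabilities\<close>

lemma finite_words: "finite (words N)"
  using finite_lists_length_eq[of "UNIV :: bool set" N] by (simp add: words_def)

text \<open>The classical part never sees the oracle, so gates, marked cells and query times are the
  same for all \<open>f\<close>.\<close>

lemma computation_classical:
  assumes "computation M f a S" "i \<le> qc_time M (length a)"
  shows "snd (S i) = (classical_step M ^^ i) (qc_init M a)"
  using assms(2)
  by (induction i) (use assms(1) in \<open>auto simp: computation_def Let_def\<close>)

lemma degree_le_apply_mat:
  assumes "\<And>v v'. degree_le d (\<lambda>x. A x v v')" "\<And>v. degree_le e (\<lambda>x. \<psi> x v)"
  shows "degree_le (d + e) (\<lambda>x. apply_mat N (A x) (\<psi> x) v)"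
  unfolding apply_mat_def
  by (cases "v \<in> words N")
    (auto intro!: degree_le_sum degree_le_mult degree_le_const assms)

text \<open>The column \<open>v'\<close> evaluates the oracle at a single word, and that value
  involves only the bit of \<open>x\<close> addressed by the counter in this word.\<close>

lemma degree_le_query_mat:
  "degree_le 1 (\<lambda>x. query_mat L n (parity_step x) v v')"
proof (rule junta[of "{horner_sum of_bool 2 (tl (take n (drop L v')))}"])
  fix x
  show "query_mat L n (parity_step x) v v'
    = query_mat L n (parity_step (x \<inter> {horner_sum of_bool 2 (tl (take n (drop L v')))})) v v'"
    unfolding query_mat_def query_map_def Let_def
    using parity_step_cong[of x "take n (drop L v')"] by simp
qed auto

text \<open>Working transforms have matrices independent of \<open>x\<close> and preserve the
  degree; each query raises it by at most one.\<close>

lemma degree_le_amplitude: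
  assumes comp: "\<And>x. computation M (parity_step x) a (S x)"
    and "i \<le> qc_time M (length a)"
  shows "degree_le (card {j. j < i \<and> head_state ((classical_step M ^^ j) (qc_init M a)) = qc_qq M})
    (\<lambda>x. fst (S x i) v)"
  using assms(2)
proof (induction i arbitrary: v)
  case 0
  have "(\<lambda>x. fst (S x 0) v) = (\<lambda>x. basic_state (zero_word (qubits M (length a))) v)"
    using comp by (auto simp: computation_def Let_def)
  then show ?case
    by (simp add: degree_le_const)
next
  case (Suc i)
  define C where "C j = (classical_step M ^^ j) (qc_init M a)" for j
  define q where "q j = card {k. k < j \<and> head_state (C k) = qc_qq M}" for j
  let ?n = "length a"
  have IH: "degree_le (q i) (\<lambda>x. fst (S x i) v)" for v
    using Suc by (simp add: q_def C_def)
  have q_mono: "q i \<le> q (Suc i)"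
    unfolding q_def by (rule card_mono) auto
  have step: "quantum_step M (parity_step x) ?n (C i) (fst (S x i)) (fst (S x (Suc i)))" for x
  proof -
    have "snd (S x i) = C i"
      using computation_classical[OF comp[of x]] Suc.prems by (simp add: C_def)
    moreover have "quantum_step M (parity_step x) ?n (snd (S x i)) (fst (S x i)) (fst (S x (Suc i)))"
      using comp[of x] Suc.prems by (simp add: computation_def Let_def)
    ultimately show ?thesis
      by simp
  qed
  consider "head_state (C i) = qc_qw M"
    | "head_state (C i) \<noteq> qc_qw M" "head_state (C i) = qc_qq M"
    | "head_state (C i) \<noteq> qc_qw M" "head_state (C i) \<noteq> qc_qq M"
    by blast
  then have "degree_le (q (Suc i)) (\<lambda>x. fst (S x (Suc i)) v)"
  proof cases
    case 1
    obtain G k U where R: "correspondence M (C i) = (G, k, U)"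
      by (cases "correspondence M (C i)") auto
    have "fst (S x (Suc i)) = apply_mat (qubits M ?n) (working_mat G U) (fst (S x i))" for x
      using step[of x] 1 R by (simp add: quantum_step_def)
    moreover have "degree_le (0 + q i)
        (\<lambda>x. apply_mat (qubits M ?n) (working_mat G U) (fst (S x i)) v)"
      \<comment> \<open>The matrix is constant in \<open>x\<close>, hence of degree 0.\<close>
      by (rule degree_le_apply_mat) (auto intro: degree_le_const IH)
    ultimately show ?thesis
      using q_mono degree_le_mono by force
  next
    case 2
    have "{k. k < Suc i \<and> head_state (C k) = qc_qq M}
        = insert i {k. k < i \<and> head_state (C k) = qc_qq M}"
      using 2 by (auto simp: less_Suc_eq)
    then have "q (Suc i) = 1 + q i"
      by (simp add: q_def)
    moreover have "fst (S x (Suc i))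
        = apply_mat (qubits M ?n) (query_mat (qc_time M ?n) ?n (parity_step x)) (fst (S x i))" for x
      using step[of x] 2 by (simp add: quantum_step_def)
    ultimately show ?thesis
      using degree_le_apply_mat[OF degree_le_query_mat IH] by simp
  next
    case 3
    then have "fst (S x (Suc i)) = fst (S x i)" for x
      using step[of x] by (simp add: quantum_step_def)
    then show ?thesis
      using degree_le_mono[OF IH q_mono] by simp
  qed
  then show ?case
    by (simp add: q_def C_def)
qed

text \<open>Squared moduli are products of an amplitude and its conjugate, which doubles the
  degree.\<close>

lemma degree_le_result_prob:
  assumes "\<And>v. degree_le d (\<lambda>x. \<psi> x v)"
  shows "degree_le (d + d) (\<lambda>x. complex_of_real (result_prob M a (\<psi> x) y))"
proof -
  have "complex_of_real (result_prob M a (\<psi> x) y)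
      = (\<Sum>w | w \<in> words (qubits M (length a)) \<and> qc_output M a w = y. \<psi> x w * cnj (\<psi> x w))" for x
    unfolding result_prob_def of_real_sum by (simp add: complex_norm_square del: of_real_power)
  then show ?thesis
    by (auto intro!: degree_le_sum degree_le_mult degree_le_cnj assms)
qed

lemma result_prob_add_le_1:
  assumes "quantum_state (qubits M (length a)) \<psi>" "y \<noteq> z"
  shows "result_prob M a \<psi> y + result_prob M a \<psi> z \<le> 1"
proof -
  let ?W = "\<lambda>y. {w. w \<in> words (qubits M (length a)) \<and> qc_output M a w = y}"
  have fin: "finite (?W y)" for y
    using finite_words by simp
  have "result_prob M a \<psi> y + result_prob M a \<psi> z
      = (\<Sum>w\<in>?W y \<union> ?W z. (cmod (\<psi> w))\<^sup>2)"
    unfolding result_prob_def using assms(2) fin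
    by (intro sum.union_disjoint[symmetric]) auto
  also have "\<dots> \<le> (\<Sum>w\<in>words (qubits M (length a)). (cmod (\<psi> w))\<^sup>2)"
    by (intro sum_mono2 finite_words) auto
  also have "\<dots> = 1"
    using assms(1) by (simp add: quantum_state_def)
  finally show ?thesis .
qed

section \<open>The lower bound on the number of queries\<close>

text \<open>The probability \<open>P x\<close> of reading odd parity exceeds 1/2 exactly for odd
  \<open>card x\<close>, so \<open>P x - 1 / 2\<close> correlates strictly with the parity of
  \<open>k\<close> bits. Its degree, at most \<open>2 * t < k\<close>, forces the correlation to
  vanish.\<close>

lemma queries_lower_bound:
  assumes T: "T (Suc m) \<le> 2 ^ m" and "2 * t < T (Suc m)"
    and comp: "\<And>f. length_preserving f \<Longrightarrow>
      computes M f (\<lambda>a. (f ^^ T (length a)) (zero_word (length a)))"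
    and eval: "\<And>f S. length_preserving f \<Longrightarrow> computation M f (zero_word (Suc m)) S \<Longrightarrow>
      evaluations M (zero_word (Suc m)) S \<le> t"
  shows False
proof -
  define a where "a = zero_word (Suc m)"
  define k where "k = T (Suc m)"
  define L where "L = qc_time M (Suc m)"
  \<comment> \<open>These are the only two possible values of the iterate: the final counter does
    not depend on \<open>x\<close>.\<close>
  define y where "y b = b # map (bit k) [0..<m]" for b
  have len: "length a = Suc m"
    by (simp add: a_def zero_word_def)
  have "\<exists>S. computation M (parity_step x) a S \<and>
      result_prob M a (fst (S L)) (y (odd (card (x \<inter> {..<k})))) \<ge> 2 / 3" for x
  proof -
    obtain p S where pS: "p \<ge> (2/3::real)" "computation M (parity_step x) a S"
      "result_prob M a (fst (S (qc_time M (length a))))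
        ((parity_step x ^^ T (length a)) (zero_word (length a))) \<ge> p"
      using comp[OF length_preserving_parity_step, of x] unfolding computes_def by blast
    then show ?thesis
      using parity_step_iterate[OF T, of x] len
      by (intro exI[of _ S]) (auto simp: y_def k_def L_def)
  qed
  then obtain S where S: "\<And>x. computation M (parity_step x) a (S x)"
    and res: "\<And>x. result_prob M a (fst (S x L)) (y (odd (card (x \<inter> {..<k})))) \<ge> 2 / 3"
    by metis
  define P where "P x = result_prob M a (fst (S x L)) (y True)" for x
  define d where
    "d = card {j. j < L \<and> head_state ((classical_step M ^^ j) (qc_init M a)) = qc_qq M}"
  \<comment> \<open>The set \<open>{}\<close> merely represents all oracles, since the query times
    do not depend on \<open>x\<close>.\<close>
  have "d = evaluations M a (S {})"
    unfolding d_def evaluations_def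
    using computation_classical[OF S[of "{}"]] len
    by (intro arg_cong[of _ _ card]) (auto simp: L_def)
  then have "d + d < card {..<k}"
    using eval[OF length_preserving_parity_step, of "{}" "S {}"] S[of "{}"] assms(2)
    by (simp add: a_def k_def)
  moreover have "degree_le d (\<lambda>x. fst (S x L) v)" for v
    using degree_le_amplitude[where S = S and M = M and a = a and i = L, OF S]
    by (simp add: d_def L_def len)
  then have "degree_le (d + d) (\<lambda>x. complex_of_real (P x))"
    unfolding P_def by (rule degree_le_result_prob)
  then have "degree_le (d + d) (\<lambda>x. complex_of_real (P x) + (- 1 / 2))"
    by (intro degree_le.add degree_le_const)
  ultimately have "(\<Sum>x\<in>Pow {..<k}. (- 1) ^ card x * (complex_of_real (P x) + (- 1 / 2))) = 0"
    by (intro sum_parity_degree_le[of "d + d"]) auto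
  also have "(\<Sum>x\<in>Pow {..<k}. (- 1) ^ card x * (complex_of_real (P x) + (- 1 / 2)))
      = complex_of_real (\<Sum>x\<in>Pow {..<k}. (- 1) ^ card x * (P x - 1 / 2))"
    by simp
  finally have "(\<Sum>x\<in>Pow {..<k}. (- 1) ^ card x * (P x - 1 / 2)) = 0"
    by (simp only: of_real_eq_0_iff)
  moreover have "(- 1) ^ card x * (P x - 1 / 2) < 0" if "x \<in> Pow {..<k}" for x
  proof (cases "odd (card x)")
    case True
    then show ?thesis
      using res[of x] that by (simp add: P_def Int_absorb2)
  next
    \<comment> \<open>Here \<open>y False\<close> has probability at least 2/3, which leaves at most
      1/3 for \<open>y True\<close>.\<close>
    case False
    have "quantum_state (qubits M (length a)) (fst (S x L))"
      using S[of x] by (auto simp: computation_def Let_def L_def len)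
    then have "P x + result_prob M a (fst (S x L)) (y False) \<le> 1"
      unfolding P_def by (rule result_prob_add_le_1) (simp add: y_def)
    then show ?thesis
      using res[of x] that False by (simp add: Int_absorb2)
  qed
  then have "(\<Sum>x\<in>Pow {..<k}. (- 1) ^ card x * (P x - 1 / 2)) < (\<Sum>x\<in>Pow {..<k}. 0)"
    by (intro sum_strict_mono) auto
  ultimately show False
    by simp
qed

theorem theorem1:
  shows "\<not> (\<exists>(M :: ('q::finite, 's::finite) qc) (t :: nat \<Rightarrow> nat) (T :: nat \<Rightarrow> nat).
    quantum_computer M \<and>
    (\<forall>\<^sub>F n in sequentially. T n > 0) \<and>
    (\<lambda>n. real (t n) / real (T n)) \<longlonglongrightarrow> 0 \<and>
    (\<lambda>n. real (T n)) \<in> O(\<lambda>n. 2 powr (real n / 7)) \<and>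
    (\<forall>f. length_preserving f \<longrightarrow>
       computes M f (\<lambda>a. (f ^^ T (length a)) (zero_word (length a))) \<and>
       (\<forall>a S. computation M f a S \<longrightarrow> evaluations M a S \<le> t (length a))))"
proof (rule notI, elim exE conjE)
  fix M :: "('q, 's) qc" and t T :: "nat \<Rightarrow> nat"
  assume pos: "\<forall>\<^sub>F n in sequentially. T n > 0"
    and lim: "(\<lambda>n. real (t n) / real (T n)) \<longlonglongrightarrow> 0"
    and bigo: "(\<lambda>n. real (T n)) \<in> O(\<lambda>n. 2 powr (real n / 7))"
    and M: "\<forall>f. length_preserving f \<longrightarrow>
       computes M f (\<lambda>a. (f ^^ T (length a)) (zero_word (length a))) \<and>
       (\<forall>a S. computation M f a S \<longrightarrow> evaluations M a S \<le> t (length a))"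
  \<comment> \<open>One of the \<open>n\<close> bits holds the parity, so the counter has
    \<open>2 ^ (n - 1)\<close> values; the growth bound keeps \<open>T n\<close> within this range
    for large \<open>n\<close>.\<close>
  have "(\<lambda>n. 2 powr (real n / 7)) \<in> o(\<lambda>n. 2 powr (real n - 1))"
    by real_asymp
  with bigo have "(\<lambda>n. real (T n)) \<in> o(\<lambda>n. 2 powr (real n - 1))"
    by (rule landau_o.big_small_trans)
  from landau_o.smallD[OF this, of 1]
  have small: "\<forall>\<^sub>F n in sequentially. real (T n) \<le> 2 powr (real n - 1)"
    by simp
  have "\<forall>\<^sub>F n in sequentially. real (t n) / real (T n) < 1 / 2"
    using order_tendstoD(2)[OF lim, of "1 / 2"] by simp
  \<comment> \<open>Since \<open>T n\<close> is positive, a ratio below 1/2 gives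
    \<open>2 * t n < T n\<close>.\<close>
  with pos small eventually_gt_at_top[of 0]
  have "\<forall>\<^sub>F n in sequentially. n > 0 \<and> real (T n) \<le> 2 powr (real n - 1) \<and> 2 * t n < T n"
    by eventually_elim (auto simp: field_simps)
  then obtain n where n: "n > 0" "real (T n) \<le> 2 powr (real n - 1)" "2 * t n < T n"
    by (auto simp: eventually_sequentially)
  then obtain m where m: "n = Suc m"
    by (cases n) auto
  have "real (T n) \<le> real (2 ^ m)"
    using n(2) m by (simp add: powr_realpow)
  then have "T (Suc m) \<le> 2 ^ m"
    using m of_nat_le_iff by blast
  moreover have "length (zero_word (Suc m)) = Suc m"
    by (simp add: zero_word_def)
  ultimately show False
    using queries_lower_bound[of T m "t n" M] n(3) M m by metis
qed

end
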